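(* Let $p>2$ be a prime, let $x,y$ be indeterminates, and for any character $\varphi$ put $M_\varphi(Z)=\sum_{k=1}^{p-1}\varphi^{-1}(k)\,Z^k$. Then for every character $\chi\neq\omega$, with $\chi^*=\omega\chi^{-1}$, we have the relation $$M_{\chi^*}\Big(\frac{-x}{y}\Big)\cdot M_{(\chi^* )^{-1}}\Big(\frac{-y}{x}\Big)=p+\Phi_p(x,y)\cdot\frac{\Psi_\chi(x,y)}{x^{p-2}\,y^{p-2}},$$ where $\Psi_\chi(x,y)$ is a symmetric homogeneous form of degree $p-3$ with coefficients in $F^+$.
   Context: $F$ is the field of $(p-1)$-th roots of unity over $\mathbb{Q}$, i.e. $F=\mathbb{Q}(\mu_{p-1})$, and $F^+$ is its maximal real subfield. Characters are characters of $g=\mathrm{Gal}(\mathbb{Q}(\zeta)/\mathbb{Q})\simeq(\mathbb{Z}/p\mathbb{Z})^\times$ ($\zeta$ a primitive $p$-th root of unity) with values in $F^\times$. A prime ideal $\mathfrak p_0$ of $F$ above $p$ is fixed and $\omega:(\mathbb{Z}/p\mathbb{Z})^\times\to\mu_{p-1}\subset F^\times$ is the Teichmüller character such that $\omega(k)\equiv k\bmod\mathfrak p_0$ for all $k$. $\Phi_p(x,y):=x^{p-1}-x^{p-2}y+\cdots-x\,y^{p-2}+y^{p-1}$. *)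

theory Defs
  imports
    "HOL-Number_Theory.Residues"
    "HOL-Algebra.Generated_Fields"
    "HOL-Computational_Algebra.Computational_Algebra"
    "HOL.Complex"
begin

text \<open>The number fields below are realised inside the complex numbers.\<close>

definition complex_ring_on :: "complex set \<Rightarrow> complex ring" where
  "complex_ring_on S = \<lparr>carrier = S, monoid.mult = (*), one = 1, zero = 0, add = (+)\<rparr>"

text \<open>\<open>\<rat>(\<mu>\<^sub>n)\<close>: a subfield of \<open>\<complex>\<close> contains \<open>\<rat>\<close> automatically, so
  generating as a field suffices.\<close>

definition cyclotomic_field :: "nat \<Rightarrow> complex set" where
  "cyclotomic_field n = generate_field (complex_ring_on UNIV) {z. z ^ n = 1}"

definition maximal_real_subfield :: "complex set \<Rightarrow> complex set" where
  "maximal_real_subfield F = F \<inter> \<real>"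

definition ring_of_integers :: "complex set \<Rightarrow> complex ring" where
  "ring_of_integers F = complex_ring_on {z \<in> F. algebraic_int z}"

definition prime_ideal_above :: "nat \<Rightarrow> complex set \<Rightarrow> complex set \<Rightarrow> bool" where
  "prime_ideal_above p F P \<longleftrightarrow>
     primeideal P (ring_of_integers F) \<and> {n :: int. of_int n \<in> P} = {n. int p dvd n}"

text \<open>The group \<open>(\<int>/p\<int>)\<^sup>\<times>\<close>, which is identified with \<open>Gal(\<rat>(\<zeta>)/\<rat>)\<close>.  For a
  prime \<open>p\<close> its carrier is \<open>{1..p-1}\<close>.\<close>

abbreviation unit_residues :: "nat \<Rightarrow> int monoid" where
  "unit_residues p \<equiv> units_of (residue_ring (int p))"

text \<open>Characters are extensional, so that equality of characters is equality of functions.\<close>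

definition characters :: "nat \<Rightarrow> complex set \<Rightarrow> (int \<Rightarrow> complex) set" where
  "characters p F =
     hom (unit_residues p) (mult_of (complex_ring_on F)) \<inter> extensional (carrier (unit_residues p))"

definition char_mult :: "nat \<Rightarrow> (int \<Rightarrow> complex) \<Rightarrow> (int \<Rightarrow> complex) \<Rightarrow> int \<Rightarrow> complex" where
  "char_mult p \<phi> \<psi> = (\<lambda>k \<in> carrier (unit_residues p). \<phi> k * \<psi> k)"

definition char_inv :: "nat \<Rightarrow> (int \<Rightarrow> complex) \<Rightarrow> int \<Rightarrow> complex" where
  "char_inv p \<phi> = (\<lambda>k \<in> carrier (unit_residues p). inverse (\<phi> k))"

definition teichmuller_character :: "nat \<Rightarrow> complex set \<Rightarrow> (int \<Rightarrow> complex) \<Rightarrow> bool" where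
  "teichmuller_character p P \<omega> \<longleftrightarrow>
     \<omega> \<in> characters p (cyclotomic_field (p - 1)) \<and>
     (\<forall>k \<in> carrier (unit_residues p). \<omega> k ^ (p - 1) = 1 \<and> \<omega> k - of_int k \<in> P)"

text \<open>Polynomials in two indeterminates have type \<open>complex poly poly\<close>, with \<open>x\<close> the inner and \<open>y\<close>
  the outer indeterminate: the coefficient of \<open>x\<^sup>i y\<^sup>j\<close> in \<open>P\<close> is \<open>coeff (coeff P j) i\<close>.\<close>

type_synonym bipoly = "complex poly poly"

definition coeff2 :: "bipoly \<Rightarrow> nat \<Rightarrow> nat \<Rightarrow> complex" where
  "coeff2 P i j = poly.coeff (poly.coeff P j) i"

definition indet_x :: "bipoly fract" where
  "indet_x = to_fract [:[:0, 1:]:]"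

definition indet_y :: "bipoly fract" where
  "indet_y = to_fract [:0, 1:]"

definition const2 :: "complex \<Rightarrow> bipoly fract" where
  "const2 c = to_fract [:[:c:]:]"

definition coeffs_in :: "complex set \<Rightarrow> bipoly \<Rightarrow> bool" where
  "coeffs_in S P \<longleftrightarrow> (\<forall>i j. coeff2 P i j \<in> S)"

definition homogeneous_of_degree :: "nat \<Rightarrow> bipoly \<Rightarrow> bool" where
  "homogeneous_of_degree d P \<longleftrightarrow> (\<forall>i j. coeff2 P i j \<noteq> 0 \<longrightarrow> i + j = d)"

definition symmetric_form :: "bipoly \<Rightarrow> bool" where
  "symmetric_form P \<longleftrightarrow> (\<forall>i j. coeff2 P i j = coeff2 P j i)"

definition M :: "nat \<Rightarrow> (int \<Rightarrow> complex) \<Rightarrow> bipoly fract \<Rightarrow> bipoly fract" where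
  "M p \<phi> Z = (\<Sum>k = 1..p - 1. const2 (char_inv p \<phi> (int k)) * Z ^ k)"

definition Phi :: "nat \<Rightarrow> 'a::comm_ring_1 \<Rightarrow> 'a \<Rightarrow> 'a" where
  "Phi p x y = (\<Sum>i = 0..p - 1. (- 1) ^ i * x ^ (p - 1 - i) * y ^ i)"

end

theory Submission
  imports Defs
begin

text \<open>
  Put \<open>\<psi> = \<chi>\<^sup>*\<close>, \<open>Z = -x/y\<close> and \<open>W = 1/Z = -y/x\<close>.  The product on the left is the Laurent
  polynomial \<open>\<Sum>\<^sub>k\<^sub>,\<^sub>l \<psi>(k)\<^sup>-\<^sup>1 \<psi>(l) Z\<^sup>k\<^sup>-\<^sup>l\<close> over \<open>1 \<le> k, l \<le> p - 1\<close>.  Let \<open>c\<^sub>d\<close> be the sum of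
  \<open>\<psi>(l + d) / \<psi>(l)\<close> over the \<open>l\<close> with \<open>1 \<le> l\<close> and \<open>l + d \<le> p - 1\<close>.  Everything follows from
  three properties of these numbers.

  The reflection \<open>l \<mapsto> p - d - l\<close> shows that replacing every summand of \<open>c\<^sub>d\<close> by its inverse does not
  change the sum (\<open>correlation_swap\<close>).  Hence \<open>Z\<^sup>d\<close> and \<open>W\<^sup>d\<close> have the same coefficient \<open>c\<^sub>d\<close>; and
  since \<open>\<psi>\<close> takes values on the unit circle, where inversion is complex conjugation, \<open>c\<^sub>d\<close> is real.

  The sum \<open>c\<^sub>d + c\<^sub>p\<^sub>-\<^sub>d\<close> is the correlation of \<open>\<psi>\<close> with its shift by \<open>d\<close> over all of \<open>\<int>/p\<int>\<close>.  It
  equals \<open>-1\<close> because \<open>\<psi>\<close> is nontrivial, which is what \<open>\<chi> \<noteq> \<omega>\<close> means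
  (\<open>correlation_complement\<close>).  Finally \<open>c\<^sub>p\<^sub>-\<^sub>1\<close> is an empty sum, so it vanishes.

  Consequently the product is congruent to \<open>p - (1 + Z + \<dots> + Z\<^sup>p\<^sup>-\<^sup>1)\<close> modulo \<open>Z\<^sup>p - 1\<close>, and therefore
  to \<open>p\<close> modulo \<open>1 + Z + \<dots> + Z\<^sup>p\<^sup>-\<^sup>1\<close>, which is \<open>\<Phi>\<^sub>p(x, y) / y\<^sup>p\<^sup>-\<^sup>1\<close>.  The quotient is explicit
  (\<open>reciprocal_sum_factorization\<close>): up to a power of \<open>Z\<close> it is the polynomial of degree at most
  \<open>p - 3\<close> with coefficients \<open>c\<^sub>j\<^sub>+\<^sub>1 - c\<^sub>j\<^sub>+\<^sub>2\<close>.  Homogenising it gives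
  \<open>\<Psi> = - \<Sum>\<^sub>j (-1)\<^sup>j (c\<^sub>j\<^sub>+\<^sub>1 - c\<^sub>j\<^sub>+\<^sub>2) x\<^sup>j y\<^sup>p\<^sup>-\<^sup>3\<^sup>-\<^sup>j\<close>.  Its coefficients are real elements of \<open>F\<close>,
  and the relation \<open>c\<^sub>d + c\<^sub>p\<^sub>-\<^sub>d = -1\<close> once more makes it symmetric.
\<close>

section \<open>Correlations of a nontrivial character modulo a prime\<close>

text \<open>Substituting a bijective affine map in a sum over \<open>\<int>/p\<int>\<close>, with residues represented by
  \<open>{..<p}\<close>.\<close>

lemma sum_residues_affine:
  fixes g :: "int \<Rightarrow> 'a::comm_monoid_add"
  assumes "p > 0" and per: "\<And>n. g (n mod int p) = g n" and cop: "coprime a (int p)"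
  shows "(\<Sum>n<p. g (a * int n + b)) = (\<Sum>n<p. g (int n))"
proof -
  define h where "h n = nat ((a * int n + b) mod int p)" for n
  have int_h: "int (h n) = (a * int n + b) mod int p" for n
    using \<open>p > 0\<close> by (simp add: h_def)
  have "inj_on h {..<p}"
  proof (rule inj_onI)
    fix m n assume mn: "m \<in> {..<p}" "n \<in> {..<p}" "h m = h n"
    then have "[a * int m + b = a * int n + b] (mod int p)"
      using int_h[of m] int_h[of n] by (simp add: cong_def)
    then have "[int m = int n] (mod int p)"
      using cop by (simp add: cong_add_rcancel cong_mult_lcancel)
    then show "m = n"
      using mn by (simp add: cong_def)
  qed
  moreover have "h ` {..<p} \<subseteq> {..<p}"
    using \<open>p > 0\<close> by (auto simp: h_def nat_less_iff)
  ultimately have "bij_betw h {..<p} {..<p}"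
    by (simp add: bij_betw_def endo_inj_surj)
  from sum.reindex_bij_betw[OF this, of "\<lambda>n. g (int n)"] show ?thesis
    by (simp add: int_h per)
qed

text \<open>Extending a character by \<open>0\<close> to the multiples of \<open>p\<close> makes it multiplicative and periodic on all
  of \<open>\<int>\<close>.  Because \<open>inverse 0 = 0\<close>, the same is true of its pointwise inverse, so that the sums
  below can run over complete residue systems without exceptions.\<close>

locale nontrivial_residue_character =
  fixes p :: nat and f :: "int \<Rightarrow> 'a::field_char_0"
  assumes prime: "prime p"
    and periodic: "f (n mod int p) = f n"
    and mult: "f (m * n) = f m * f n"
    and eq_0_iff: "f n = 0 \<longleftrightarrow> int p dvd n"
    and nontrivial: "\<exists>n. \<not> int p dvd n \<and> f n \<noteq> 1"
begin

text \<open>The range of summation stops where \<open>l + d\<close> would wrap around modulo \<open>p\<close>; the summand at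
  \<open>l = 0\<close> is \<open>0\<close>.\<close>

definition correlation :: "nat \<Rightarrow> 'a" where
  "correlation d = (\<Sum>l<p - d. f (int (l + d)) * inverse (f (int l)))"

lemma p_pos: "p > 0"
  using prime by (simp add: prime_gt_0_nat)

lemma coprime_p: "\<not> int p dvd a \<Longrightarrow> coprime a (int p)"
  using prime prime_imp_coprime[of "int p" a] by (simp add: coprime_commute)

lemma at_0 [simp]: "f 0 = 0"
  by (simp add: eq_0_iff)

lemma at_1 [simp]: "f 1 = 1"
proof -
  have "f 1 \<noteq> 0"
    using prime by (auto simp: eq_0_iff)
  then show ?thesis
    using mult[of 1 1] by simp
qed

lemma add_p: "f (n + int p) = f n"
  using periodic[of "n + int p"] periodic[of n] by simp

lemma periodic_shift: "f (n mod int p + d) = f (n + d)"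
  using periodic[of "n mod int p + d"] periodic[of "n + d"] by (simp add: mod_simps)

text \<open>Multiplication by a unit \<open>m\<close> permutes the residues and scales the sum by \<open>f m\<close>, which can be
  chosen different from \<open>1\<close>.\<close>

lemma sum_eq_0: "(\<Sum>n<p. f (int n)) = 0"
proof -
  obtain m where m: "\<not> int p dvd m" "f m \<noteq> 1"
    using nontrivial by blast
  have "(\<Sum>n<p. f (m * int n + 0)) = (\<Sum>n<p. f (int n))"
    by (rule sum_residues_affine) (use p_pos coprime_p m periodic in auto)
  then have "f m * (\<Sum>n<p. f (int n)) = (\<Sum>n<p. f (int n))"
    by (simp add: mult sum_distrib_left)
  then show ?thesis
    using m by simp
qed

lemma sum_mult_inverse: "(\<Sum>n<p. f (int n) * inverse (f (int n))) = of_nat p - 1"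
proof -
  have "(\<Sum>n<p. f (int n) * inverse (f (int n))) = (\<Sum>n<p. if n = 0 then 0 else 1)"
  proof (rule sum.cong)
    fix n assume "n \<in> {..<p}"
    then have "f (int n) \<noteq> 0" if "n \<noteq> 0"
      using that by (auto simp: eq_0_iff dest: dvd_imp_le)
    then show "f (int n) * inverse (f (int n)) = (if n = 0 then 0 else 1)"
      by simp
  qed simp
  also have "\<dots> = (\<Sum>n\<in>{..<p} - {0}. 1)"
    by (intro sum.mono_neutral_cong_right) auto
  also have "\<dots> = of_nat p - 1"
    using p_pos by (simp add: of_nat_diff)
  finally show ?thesis .
qed

text \<open>Replace \<open>n\<close> by \<open>d * n\<close>: the factor \<open>f d\<close> cancels.\<close>

lemma cyclic_correlation_dilate:
  assumes "\<not> int p dvd d"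
  shows "(\<Sum>n<p. f (int n + d) * inverse (f (int n))) = (\<Sum>n<p. f (int n + 1) * inverse (f (int n)))"
proof -
  have "(\<Sum>n<p. f (int n + d) * inverse (f (int n)))
      = (\<Sum>n<p. f ((d * int n + 0) + d) * inverse (f (d * int n + 0)))"
    by (rule sum_residues_affine[symmetric])
       (use p_pos coprime_p assms periodic periodic_shift in auto)
  also have "\<dots> = (\<Sum>n<p. f (d * (int n + 1)) * inverse (f (d * int n)))"
    by (simp add: algebra_simps)
  also have "\<dots> = (\<Sum>n<p. f (int n + 1) * inverse (f (int n)))"
  proof (rule sum.cong)
    fix n
    have "f d \<noteq> 0"
      using assms by (simp add: eq_0_iff)
    then show "f (d * (int n + 1)) * inverse (f (d * int n)) = f (int n + 1) * inverse (f (int n))"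
      by (simp only: mult) simp
  qed simp
  finally show ?thesis .
qed

text \<open>The correlations at all shifts add up to \<open>0\<close>, since \<open>f\<close> itself sums to \<open>0\<close>.  The shift \<open>0\<close>
  contributes \<open>p - 1\<close> and the \<open>p - 1\<close> other shifts contribute equally, so each of them gives \<open>-1\<close>.\<close>

lemma cyclic_correlation:
  assumes "\<not> int p dvd d"
  shows "(\<Sum>n<p. f (int n + d) * inverse (f (int n))) = -1"
proof -
  define J where "J d = (\<Sum>n<p. f (int n + d) * inverse (f (int n)))" for d
  have "(\<Sum>d<p. J (int d)) = (\<Sum>n<p. (\<Sum>d<p. f (1 * int d + int n)) * inverse (f (int n)))"
    unfolding J_def sum_distrib_right by (subst sum.swap) (simp add: add.commute)
  also have "\<dots> = 0"
    by (subst sum_residues_affine) (use p_pos periodic sum_eq_0 in auto)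
  finally have "(\<Sum>d<p. J (int d)) = 0" .
  moreover have "(\<Sum>d<p. J (int d)) = J 0 + (\<Sum>d\<in>{..<p} - {0}. J (int d))"
    using p_pos by (subst sum.remove[of _ 0]) auto
  moreover have "(\<Sum>d\<in>{..<p} - {0}. J (int d)) = (\<Sum>d\<in>{..<p} - {0}. J 1)"
  proof (rule sum.cong)
    fix d assume "d \<in> {..<p} - {0}"
    then have "\<not> int p dvd int d"
      by (auto dest: dvd_imp_le)
    then show "J (int d) = J 1"
      unfolding J_def by (rule cyclic_correlation_dilate)
  qed simp
  moreover have "J 0 = of_nat p - 1"
    by (simp add: J_def sum_mult_inverse)
  ultimately have "(of_nat p - 1) * (J 1 + 1) = 0"
    using p_pos by (simp add: of_nat_diff algebra_simps)
  moreover have "(of_nat p :: 'a) - 1 \<noteq> 0"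
    using prime by (metis not_prime_1 of_nat_eq_1_iff right_minus_eq)
  ultimately have "J 1 = -1"
    by (simp add: eq_neg_iff_add_eq_0)
  then show ?thesis
    using cyclic_correlation_dilate[OF assms] by (simp add: J_def)
qed

text \<open>Reflecting the range of summation exchanges numerator and denominator up to the sign of both
  arguments, and the factors \<open>f (-1)\<close> cancel.\<close>

lemma correlation_swap:
  "correlation d = (\<Sum>l<p - d. f (int l) * inverse (f (int (l + d))))"
proof (cases "d < p")
  case True
  have neg: "f (- a) * inverse (f (- b)) = f a * inverse (f b)" for a b
  proof -
    have "f (-1) \<noteq> 0"
      using prime by (auto simp: eq_0_iff)
    then show ?thesis
      using mult[of "-1" a] mult[of "-1" b] by (simp add: field_simps)
  qed
  \<comment> \<open>The endpoint \<open>l = p - d\<close> is a multiple of \<open>p\<close> after the shift, so it contributes nothing to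
    either sum and makes the range invariant under \<open>l \<mapsto> p - d - l\<close>.\<close>
  have "correlation d = (\<Sum>l\<le>p - d. f (int (l + d)) * inverse (f (int l)))"
    using True by (simp add: correlation_def lessThan_Suc_atMost[symmetric] eq_0_iff)
  also have "\<dots> = (\<Sum>l\<le>p - d. f (int (p - d - l + d)) * inverse (f (int (p - d - l))))"
    unfolding atMost_atLeast0 by (subst sum.atLeastAtMost_rev) simp
  also have "\<dots> = (\<Sum>l\<le>p - d. f (int l) * inverse (f (int (l + d))))"
  proof (rule sum.cong)
    fix l assume "l \<in> {..p - d}"
    then have "int (p - d - l + d) = - int l + int p" "int (p - d - l) = - int (l + d) + int p"
      using True by auto
    then show "f (int (p - d - l + d)) * inverse (f (int (p - d - l)))
             = f (int l) * inverse (f (int (l + d)))"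
      by (simp only: add_p neg)
  qed simp
  also have "\<dots> = (\<Sum>l<p - d. f (int l) * inverse (f (int (l + d))))"
    using True by (simp add: lessThan_Suc_atMost[symmetric] eq_0_iff)
  finally show ?thesis .
qed (simp add: correlation_def)

text \<open>The two correlations are the parts of the cyclic correlation before and after the shift wraps
  around \<open>p\<close>; the second part appears in the inverted form of \<open>correlation_swap\<close>.\<close>

lemma correlation_complement:
  assumes "0 < d" "d < p"
  shows "correlation d + correlation (p - d) = -1"
proof -
  define t where "t l = f (int l + int d) * inverse (f (int l))" for l
  have "correlation (p - d) = (\<Sum>l<d. t (l + (p - d)))"
  proof -
    have "t (l + (p - d)) = f (int l) * inverse (f (int (l + (p - d))))" for l
      using add_p[of "int l"] assms by (simp add: t_def of_nat_diff)
    then show ?thesis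
      using assms by (simp add: correlation_swap)
  qed
  then have "correlation d + correlation (p - d) = (\<Sum>l<p - d. t l) + (\<Sum>l<d. t (l + (p - d)))"
    by (simp add: correlation_def t_def)
  also have "(\<Sum>l<d. t (l + (p - d))) = (\<Sum>l=p - d..<p. t l)"
    using sum.shift_bounds_nat_ivl[of t 0 "p - d" d] assms by (simp add: lessThan_atLeast0)
  also have "(\<Sum>l<p - d. t l) + \<dots> = (\<Sum>l<p. t l)"
    by (simp add: lessThan_atLeast0 sum.atLeastLessThan_concat)
  also have "\<dots> = -1"
    unfolding t_def using assms by (intro cyclic_correlation) (auto dest: dvd_imp_le)
  finally show ?thesis .
qed

lemma correlation_last: "correlation (p - 1) = 0"
proof -
  have "p - (p - 1) = 1"
    using p_pos by simp
  then show ?thesis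
    by (simp add: correlation_def)
qed

end

lemma norm_residue_character:
  fixes f :: "int \<Rightarrow> complex"
  assumes "nontrivial_residue_character p f" "\<not> int p dvd n"
  shows "norm (f n) = 1"
proof -
  interpret nontrivial_residue_character p f by fact
  have pow: "f (n ^ k) = f n ^ k" for k
    by (induction k) (auto simp: mult)
  have "[n ^ (p - 1) = 1] (mod int p)"
  proof -
    obtain m where m: "int m = n mod int p"
      using p_pos by (metis nonneg_int_cases of_nat_0_less_iff pos_mod_sign)
    have "\<not> p dvd m"
      using m assms(2) by (metis dvd_mod_iff dvd_refl int_dvd_int_iff)
    then have "[m ^ (p - 1) = 1] (mod p)"
      using prime fermat_theorem by blast
    then have "[int m ^ (p - 1) = 1] (mod int p)"
      using cong_int_iff[of "m ^ (p - 1)" 1 p] by simp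
    then show ?thesis
      using m by (simp add: cong_def power_mod)
  qed
  then have "f n ^ (p - 1) = 1"
    using periodic[of "n ^ (p - 1)"] periodic[of 1] by (simp add: cong_def pow)
  then show ?thesis
    using power_eq_1_iff[of "f n" "p - 1"] prime_gt_1_nat[OF prime] by auto
qed

text \<open>On the unit circle inversion is conjugation, so \<open>correlation_swap\<close> says that the correlation
  equals its conjugate.\<close>

lemma correlation_real:
  fixes f :: "int \<Rightarrow> complex"
  assumes "nontrivial_residue_character p f"
  shows "nontrivial_residue_character.correlation p f d \<in> \<real>"
proof -
  interpret nontrivial_residue_character p f by fact
  have cnj: "cnj (f n) = inverse (f n)" for n
  proof (cases "int p dvd n")
    case True
    then have "f n = 0"
      by (simp only: eq_0_iff)
    then show ?thesis
      by simp
  next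
    case False
    then have "f n * cnj (f n) = 1"
      using norm_residue_character[OF assms False] complex_norm_square[of "f n"] by simp
    then show ?thesis
      by (simp only: inverse_unique)
  qed
  have "cnj (correlation d) = (\<Sum>l<p - d. f (int l) * inverse (f (int (l + d))))"
    by (simp add: correlation_def cnj mult.commute)
  then show ?thesis
    by (simp only: Reals_cnj_iff flip: correlation_swap)
qed

section \<open>Two identities for reciprocal pairs\<close>

text \<open>Collecting the terms of the product by the exponent \<open>k - l\<close>.  The induction step adds the
  terms with \<open>k = n\<close> or \<open>l = n\<close>, which is exactly one new summand in each coefficient.\<close>

lemma product_eq_correlation_sum:
  fixes a b :: "nat \<Rightarrow> 'a::comm_ring_1"
  assumes "Z * W = 1"
  shows "(\<Sum>k<n. a k * Z ^ k) * (\<Sum>l<n. b l * W ^ l) =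
    (\<Sum>k<n. a k * b k) +
    (\<Sum>d=1..<n. (\<Sum>l<n - d. a (l + d) * b l) * Z ^ d + (\<Sum>l<n - d. a l * b (l + d)) * W ^ d)"
proof (induction n)
  case (Suc n)
  have ZW: "Z ^ k * W ^ k = 1" for k
    using assms by (metis power_mult_distrib power_one)
  have new: "u n * X ^ n * (\<Sum>l<n. v l * Y ^ l) = (\<Sum>d=1..<Suc n. u n * v (n - d) * X ^ d)"
    if XY: "\<And>k. X ^ k * Y ^ k = 1" for u v :: "nat \<Rightarrow> 'a" and X Y
  proof -
    have "u n * X ^ n * (\<Sum>l<n. v l * Y ^ l) = (\<Sum>l<n. u n * v l * X ^ (n - l))"
    proof -
      have "X ^ n * Y ^ l = X ^ (n - l)" if "l < n" for l
      proof -
        have "X ^ n = X ^ (n - l) * X ^ l"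
          using that by (simp flip: power_add)
        then show ?thesis
          using XY[of l] by (simp add: mult.assoc)
      qed
      then show ?thesis
        unfolding sum_distrib_left by (intro sum.cong) (auto simp: ac_simps)
    qed
    also have "\<dots> = (\<Sum>d=1..<Suc n. u n * v (n - d) * X ^ d)"
      by (rule sum.reindex_bij_witness[where i = "\<lambda>d. n - d" and j = "\<lambda>l. n - l"]) auto
    finally show ?thesis .
  qed
  have coeff_step: "(\<Sum>d=1..<Suc n. (\<Sum>l<Suc n - d. g l d) * X ^ d)
      = (\<Sum>d=1..<n. (\<Sum>l<n - d. g l d) * X ^ d) + (\<Sum>d=1..<Suc n. g (n - d) d * X ^ d)"
    for g :: "nat \<Rightarrow> nat \<Rightarrow> 'a" and X
  proof -
    have "(\<Sum>d=1..<Suc n. (\<Sum>l<Suc n - d. g l d) * X ^ d)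
        = (\<Sum>d=1..<Suc n. (\<Sum>l<n - d. g l d) * X ^ d + g (n - d) d * X ^ d)"
      by (intro sum.cong) (auto simp: Suc_diff_le distrib_right)
    then show ?thesis
      by (cases n) (auto simp: sum.distrib)
  qed
  have new_a: "a n * Z ^ n * (\<Sum>l<n. b l * W ^ l) = (\<Sum>d=1..<Suc n. a n * b (n - d) * Z ^ d)"
    by (rule new) (rule ZW)
  have new_b: "b n * W ^ n * (\<Sum>l<n. a l * Z ^ l) = (\<Sum>d=1..<Suc n. b n * a (n - d) * W ^ d)"
    by (rule new) (subst mult.commute, rule ZW)
  have expand: "(A + u) * (B + v) = A * B + u * v + u * B + v * A" for A B u v :: 'a
    by (simp add: algebra_simps)
  have corner: "a n * Z ^ n * (b n * W ^ n) = a n * b n"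
  proof -
    have "a n * Z ^ n * (b n * W ^ n) = a n * b n * (Z ^ n * W ^ n)"
      by (simp only: ac_simps)
    then show ?thesis
      by (simp only: ZW mult_1_right)
  qed
  have "(\<Sum>k<Suc n. a k * Z ^ k) * (\<Sum>l<Suc n. b l * W ^ l) =
      (\<Sum>k<n. a k * Z ^ k) * (\<Sum>l<n. b l * W ^ l) + a n * b n +
      a n * Z ^ n * (\<Sum>l<n. b l * W ^ l) + b n * W ^ n * (\<Sum>l<n. a l * Z ^ l)"
    unfolding sum.lessThan_Suc expand corner ..
  also have "\<dots> = (\<Sum>k<Suc n. a k * b k) +
    ((\<Sum>d=1..<Suc n. (\<Sum>l<Suc n - d. a (l + d) * b l) * Z ^ d) +
     (\<Sum>d=1..<Suc n. (\<Sum>l<Suc n - d. a l * b (l + d)) * W ^ d))"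
    unfolding Suc.IH new_a new_b coeff_step
    by (simp add: sum.distrib mult.commute)
  finally show ?case
    by (simp only: sum.distrib)
qed simp

text \<open>With \<open>S = 1 + Z + \<dots> + Z\<^sup>p\<^sup>-\<^sup>1\<close> and \<open>C = \<Sum> c\<^sub>d Z\<^sup>d\<close>, the relation between \<open>c\<^sub>d\<close> and \<open>c\<^sub>p\<^sub>-\<^sub>d\<close>
  turns the negative half of the sum into \<open>W\<^sup>p (1 - S - C)\<close>.  As \<open>Z\<^sup>p - 1 = (Z - 1) S\<close>, the whole left
  side becomes \<open>W\<^sup>p S ((Z - 1) C - Z)\<close>, and the last factor is a telescoped form of the quotient.\<close>

lemma reciprocal_sum_factorization:
  fixes c :: "nat \<Rightarrow> 'a::comm_ring_1"
  assumes "p \<ge> 2" and ZW: "Z * W = 1"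
    and compl: "\<And>d. 0 < d \<Longrightarrow> d < p \<Longrightarrow> c d + c (p - d) = -1"
    and last: "c (p - 1) = 0"
  shows "(\<Sum>d=1..<p. c d * (Z ^ d + W ^ d)) - 1 =
    (\<Sum>j<p. Z ^ j) * W ^ (p - 2) * (\<Sum>j<p - 2. (c (j + 1) - c (j + 2)) * Z ^ j)"
proof -
  obtain m where p: "p = Suc (Suc m)"
    using \<open>p \<ge> 2\<close> by (metis add_2_eq_Suc le_Suc_ex)
  define S where "S = (\<Sum>j<p. Z ^ j)"
  define C where "C = (\<Sum>d=1..<p. c d * Z ^ d)"
  define Q where "Q = (\<Sum>j<m. (c (j + 1) - c (j + 2)) * Z ^ j)"
  have ZWk: "Z ^ k * W ^ k = 1" for k
    using ZW by (metis power_mult_distrib power_one)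
  have cancel: "W ^ k * (Z ^ k * u) = u" for k u
    using ZWk[of k] by (simp add: mult.commute[of "W ^ k"] flip: mult.assoc)
  have S': "S = 1 + (\<Sum>d=1..<p. Z ^ d)"
    unfolding S_def p by (simp add: lessThan_atLeast0 sum.atLeast_Suc_lessThan)
  have geom: "(Z - 1) * S = Z ^ p - 1"
    unfolding S_def by (metis power_diff_1_eq)
  \<comment> \<open>After multiplication by \<open>Z ^ p\<close> the negative powers become positive ones, in reverse order.\<close>
  have "Z ^ p * (\<Sum>d=1..<p. c d * W ^ d) = (\<Sum>d=1..<p. c d * Z ^ (p - d))"
  proof -
    have "Z ^ p * W ^ d = Z ^ (p - d)" if "d < p" for d
    proof -
      have "Z ^ p = Z ^ (p - d) * Z ^ d"
        using that by (simp flip: power_add)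
      then show ?thesis
        using ZWk[of d] by (simp add: mult.assoc)
    qed
    then show ?thesis
      unfolding sum_distrib_left by (intro sum.cong) (auto simp: mult.left_commute)
  qed
  also have "\<dots> = (\<Sum>d=1..<p. c (p - d) * Z ^ d)"
    by (rule sum.reindex_bij_witness[where i = "\<lambda>d. p - d" and j = "\<lambda>d. p - d"]) auto
  also have "\<dots> = (\<Sum>d=1..<p. (- 1 - c d) * Z ^ d)"
  proof (rule sum.cong)
    fix d assume "d \<in> {1..<p}"
    then have "c (p - d) = - 1 - c d"
      using compl[of d] by (simp add: eq_diff_eq add.commute)
    then show "c (p - d) * Z ^ d = (- 1 - c d) * Z ^ d"
      by simp
  qed simp
  also have "\<dots> = 1 - S - C"
    by (simp add: S' C_def left_diff_distrib sum_subtractf sum_negf)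
  finally have "W ^ p * (Z ^ p * (\<Sum>d=1..<p. c d * W ^ d)) = W ^ p * (1 - S - C)"
    by simp
  then have neg: "(\<Sum>d=1..<p. c d * W ^ d) = W ^ p * (1 - S - C)"
    by (simp only: cancel)
  \<comment> \<open>The coefficients of \<open>Z\<close> and of \<open>Z ^ p\<close> vanish, since \<open>c 1 = -1\<close> and \<open>c (p - 1) = 0\<close>.\<close>
  have quot: "(Z - 1) * C - Z = Z ^ 2 * Q"
  proof -
    have c1: "c 1 = -1"
      using compl[of 1] last p by simp
    have C1: "C = (\<Sum>j<Suc m. c (j + 1) * Z ^ (j + 1))"
      unfolding C_def p by (rule sum.reindex_bij_witness[where i = "\<lambda>d. d + 1" and j = "\<lambda>d. d - 1"]) auto
    have ZC: "Z * C = Z * Z * (\<Sum>j<m. c (j + 1) * Z ^ j)"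
      using last unfolding C1 p by (simp add: sum_distrib_left ac_simps)
    have "C = - Z + Z * Z * (\<Sum>j<m. c (j + 2) * Z ^ j)"
      using c1 unfolding C1 sum.lessThan_Suc_shift by (simp add: sum_distrib_left ac_simps)
    then have CZ: "C + Z = Z * Z * (\<Sum>j<m. c (j + 2) * Z ^ j)"
      by simp
    have "(Z - 1) * C - Z = Z * C - (C + Z)"
      by (simp add: algebra_simps)
    then show ?thesis
      unfolding ZC CZ
      by (simp add: Q_def left_diff_distrib right_diff_distrib sum_subtractf power2_eq_square)
  qed
  have "(\<Sum>d=1..<p. c d * (Z ^ d + W ^ d)) - 1 = C + W ^ p * (1 - S - C) - 1"
    by (simp only: distrib_left sum.distrib neg flip: C_def)
  also have "\<dots> = W ^ p * (Z ^ p * (C - 1)) + W ^ p * (1 - S - C)"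
    unfolding cancel by simp
  also have "\<dots> = W ^ p * ((Z ^ p - 1) * (C - 1) - S)"
    by (simp add: algebra_simps)
  also have "\<dots> = W ^ p * S * ((Z - 1) * C - Z)"
    unfolding geom[symmetric] by (simp add: algebra_simps)
  also have "\<dots> = W ^ p * Z ^ 2 * S * Q"
    unfolding quot by (simp add: ac_simps)
  also have "W ^ p * Z ^ 2 = W ^ m * (W ^ 2 * (Z ^ 2 * 1))"
    by (simp add: p power2_eq_square ac_simps)
  also have "\<dots> = W ^ m"
    unfolding cancel by simp
  finally show ?thesis
    by (simp add: S_def Q_def p ac_simps)
qed


section \<open>Cyclotomic fields and their characters\<close>

lemma field_complex: "field (complex_ring_on UNIV)"
proof -
  let ?R = "complex_ring_on UNIV"
  have "abelian_group ?R"
  proof (rule abelian_groupI)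
    fix x assume "x \<in> carrier ?R"
    show "\<exists>y\<in>carrier ?R. y \<oplus>\<^bsub>?R\<^esub> x = \<zero>\<^bsub>?R\<^esub>"
      by (rule bexI[of _ "- x"]) (simp_all add: complex_ring_on_def)
  qed (simp_all add: complex_ring_on_def)
  moreover have "comm_monoid ?R"
    by (rule comm_monoidI) (simp_all add: complex_ring_on_def)
  ultimately have "cring ?R"
    by (rule cringI) (simp add: complex_ring_on_def distrib_right)
  moreover have "Units ?R = carrier ?R - {\<zero>\<^bsub>?R\<^esub>}"
  proof -
    have "\<exists>y. y * x = 1 \<and> x * y = 1" if "x \<noteq> 0" for x :: complex
      by (rule exI[of _ "inverse x"]) (simp add: that)
    then show ?thesis
      by (auto simp: Units_def complex_ring_on_def)
  qed
  ultimately show ?thesis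
    by (rule cring.cring_fieldI)
qed

lemma cyclotomic_field_closed:
  shows cyclotomic_field_1: "1 \<in> cyclotomic_field n"
    and cyclotomic_field_add: "a \<in> cyclotomic_field n \<Longrightarrow> b \<in> cyclotomic_field n \<Longrightarrow> a + b \<in> cyclotomic_field n"
    and cyclotomic_field_mult: "a \<in> cyclotomic_field n \<Longrightarrow> b \<in> cyclotomic_field n \<Longrightarrow> a * b \<in> cyclotomic_field n"
    and cyclotomic_field_uminus: "a \<in> cyclotomic_field n \<Longrightarrow> - a \<in> cyclotomic_field n"
    and cyclotomic_field_inverse: "a \<in> cyclotomic_field n \<Longrightarrow> a \<noteq> 0 \<Longrightarrow> inverse a \<in> cyclotomic_field n"
proof -
  interpret field "complex_ring_on UNIV" by (rule field_complex)
  show "1 \<in> cyclotomic_field n"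
    using generate_field.one[of "complex_ring_on UNIV"]
    by (simp add: cyclotomic_field_def complex_ring_on_def)
  show "a + b \<in> cyclotomic_field n" if "a \<in> cyclotomic_field n" "b \<in> cyclotomic_field n"
    using generate_field.eng_add[of a "complex_ring_on UNIV" _ b] that
    by (simp add: cyclotomic_field_def complex_ring_on_def)
  show "a * b \<in> cyclotomic_field n" if "a \<in> cyclotomic_field n" "b \<in> cyclotomic_field n"
    using generate_field.eng_mult[of a "complex_ring_on UNIV" _ b] that
    by (simp add: cyclotomic_field_def complex_ring_on_def)
  show "- a \<in> cyclotomic_field n" if "a \<in> cyclotomic_field n"
  proof -
    have "\<ominus>\<^bsub>complex_ring_on UNIV\<^esub> a = - a"
      by (rule minus_equality) (simp_all add: complex_ring_on_def)
    then show ?thesis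
      using generate_field.a_inv[of a "complex_ring_on UNIV"] that
      by (simp add: cyclotomic_field_def)
  qed
  show "inverse a \<in> cyclotomic_field n" if "a \<in> cyclotomic_field n" "a \<noteq> 0"
  proof -
    have "inverse a = inv\<^bsub>complex_ring_on UNIV\<^esub> a"
      by (rule inv_unique') (simp_all add: complex_ring_on_def that)
    moreover have "a \<noteq> \<zero>\<^bsub>complex_ring_on UNIV\<^esub>"
      using that by (simp add: complex_ring_on_def)
    ultimately show ?thesis
      using generate_field.m_inv[of a "complex_ring_on UNIV"] that
      by (simp add: cyclotomic_field_def)
  qed
qed

lemma cyclotomic_field_0: "0 \<in> cyclotomic_field n"
  using cyclotomic_field_add[OF cyclotomic_field_1 cyclotomic_field_uminus[OF cyclotomic_field_1]]
  by simp

lemma cyclotomic_field_sum: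
  "(\<And>i. i \<in> A \<Longrightarrow> g i \<in> cyclotomic_field n) \<Longrightarrow> sum g A \<in> cyclotomic_field n"
  by (induction A rule: infinite_finite_induct)
     (auto simp: cyclotomic_field_0 cyclotomic_field_add)

lemma mod_in_units:
  assumes "p > 0" "\<not> int p dvd n"
  shows "n mod int p \<in> {1..int p - 1}"
proof -
  have "n mod int p \<noteq> 0"
    using assms by (simp add: dvd_eq_mod_eq_0)
  moreover have "0 \<le> n mod int p" "n mod int p < int p"
    using assms by simp_all
  ultimately show ?thesis
    unfolding atLeastAtMost_iff by linarith
qed

lemma carrier_unit_residues:
  assumes "prime p"
  shows "carrier (unit_residues p) = {1..int p - 1}"
proof -
  interpret residues_prime p "residue_ring (int p)"
    by unfold_locales (use assms in auto)
  show ?thesis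
    using prime_gt_0_nat[OF assms] by (simp only: units_of_carrier res_prime_units_eq)
      (simp add: of_nat_diff Suc_le_eq)
qed

lemma
  assumes "prime p" "\<phi> \<in> characters p F" "k \<in> {1..int p - 1}"
  shows character_mult: "l \<in> {1..int p - 1} \<Longrightarrow> \<phi> (k * l mod int p) = \<phi> k * \<phi> l"
    and character_in_field: "\<phi> k \<in> F"
    and character_nonzero: "\<phi> k \<noteq> 0"
proof -
  have hom: "\<phi> \<in> hom (unit_residues p) (mult_of (complex_ring_on F))"
    using assms(2) by (simp add: characters_def)
  have k: "k \<in> carrier (unit_residues p)"
    using assms(3) by (simp only: carrier_unit_residues[OF assms(1)])
  have "\<phi> k \<in> F - {0}"
    using hom_in_carrier[OF hom k] by (simp add: complex_ring_on_def)
  then show "\<phi> k \<in> F" "\<phi> k \<noteq> 0"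
    by auto
  show "\<phi> (k * l mod int p) = \<phi> k * \<phi> l" if "l \<in> {1..int p - 1}"
  proof -
    have "l \<in> carrier (unit_residues p)"
      using that by (simp only: carrier_unit_residues[OF assms(1)])
    then show ?thesis
      using hom_mult[OF hom k] by (simp add: units_of_mult residue_ring_def complex_ring_on_def)
  qed
qed

lemma zero_extension_character:
  fixes \<phi> :: "int \<Rightarrow> 'a::field_char_0"
  assumes "prime p"
    and mult: "\<And>k l. k \<in> {1..int p - 1} \<Longrightarrow> l \<in> {1..int p - 1} \<Longrightarrow> \<phi> (k * l mod int p) = \<phi> k * \<phi> l"
    and nonzero: "\<And>k. k \<in> {1..int p - 1} \<Longrightarrow> \<phi> k \<noteq> 0"
    and nontrivial: "\<exists>k\<in>{1..int p - 1}. \<phi> k \<noteq> 1"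
  shows "nontrivial_residue_character p (\<lambda>n. if int p dvd n then 0 else \<phi> (n mod int p))"
proof
  note range = mod_in_units[OF prime_gt_0_nat[OF \<open>prime p\<close>]]
  fix m n
  show "prime p" by fact
  show "(if int p dvd n mod int p then 0 else \<phi> (n mod int p mod int p))
      = (if int p dvd n then 0 else \<phi> (n mod int p))"
    by (simp add: dvd_mod_iff)
  show "(if int p dvd m * n then 0 else \<phi> (m * n mod int p))
      = (if int p dvd m then 0 else \<phi> (m mod int p)) * (if int p dvd n then 0 else \<phi> (n mod int p))"
    using mult[OF range[of m] range[of n]] assms(1)
    by (simp add: prime_dvd_mult_iff mod_mult_eq)
  show "(if int p dvd n then 0 else \<phi> (n mod int p)) = 0 \<longleftrightarrow> int p dvd n"
    using nonzero range by simp
  obtain k where k: "k \<in> {1..int p - 1}" "\<phi> k \<noteq> 1"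
    using nontrivial by blast
  then have "\<not> int p dvd k"
    by (auto dest: zdvd_imp_le)
  with k show "\<exists>n. \<not> int p dvd n \<and> (if int p dvd n then 0 else \<phi> (n mod int p)) \<noteq> 1"
    by (intro exI[of _ k]) auto
qed

section \<open>Forms in two indeterminates\<close>

lemma const2_add: "const2 (a + b) = const2 a + const2 b"
  by (simp add: const2_def flip: to_fract_add)

lemma const2_diff: "const2 (a - b) = const2 a - const2 b"
  by (simp add: const2_def flip: to_fract_diff)

lemma const2_mult: "const2 (a * b) = const2 a * const2 b"
  by (simp add: const2_def flip: to_fract_mult)

lemma const2_0: "const2 0 = 0"
  by (simp add: const2_def)

lemma const2_1: "const2 1 = 1"
  by (simp add: const2_def flip: one_pCons)

lemma const2_minus: "const2 (- a) = - const2 a"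
  using const2_diff[of 0 a] by (simp add: const2_0)

lemma const2_sum: "const2 (sum g A) = (\<Sum>i\<in>A. const2 (g i))"
  by (induction A rule: infinite_finite_induct) (simp_all add: const2_0 const2_add)

lemma const2_of_nat: "const2 (of_nat n) = of_nat n"
  by (induction n) (simp_all add: const2_0 const2_1 const2_add)

lemma const2_power: "const2 (a ^ n) = const2 a ^ n"
  by (induction n) (simp_all add: const2_1 const2_mult)

lemma to_fract_power: "to_fract (a ^ n) = to_fract a ^ n"
  by (induction n) simp_all

lemma to_fract_monom2: "to_fract (monom (monom c i) j) = const2 c * indet_x ^ i * indet_y ^ j"
proof -
  have "monom (monom c i) j = [:[:c:]:] * [:[:0, 1:]:] ^ i * [:0, 1:] ^ j"
    by (simp add: monom_altdef poly_const_pow)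
  then show ?thesis
    by (simp only: const2_def indet_x_def indet_y_def to_fract_mult to_fract_power)
qed

definition binary_form :: "nat \<Rightarrow> (nat \<Rightarrow> complex) \<Rightarrow> bipoly" where
  "binary_form d q = (\<Sum>i\<le>d. monom (monom (q i) i) (d - i))"

lemma coeff2_binary_form: "coeff2 (binary_form d q) i j = (if i + j = d then q i else 0)"
proof -
  have "coeff2 (binary_form d q) i j = (\<Sum>k\<le>d. if k = i then (if d - i = j then q i else 0) else 0)"
    unfolding coeff2_def binary_form_def coeff_sum by (intro sum.cong) auto
  then show ?thesis
    by auto
qed

lemma to_fract_binary_form:
  "to_fract (binary_form d q) = (\<Sum>i\<le>d. const2 (q i) * indet_x ^ i * indet_y ^ (d - i))"
  by (simp add: binary_form_def to_fract_monom2)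

text \<open>Since \<open>p - 1\<close> is even, the alternating signs of \<open>Phi\<close> are absorbed by the powers of \<open>- x / y\<close>
  when the form is read backwards.\<close>

lemma Phi_eq_geometric_sum:
  fixes x y :: "'a::field"
  assumes "odd p" "y \<noteq> 0"
  shows "Phi p x y = y ^ (p - 1) * (\<Sum>j<p. (- x / y) ^ j)"
proof -
  have "Phi p x y = (\<Sum>i = 0..p - 1. (- 1) ^ (p - 1 - i) * x ^ (p - 1 - (p - 1 - i)) * y ^ (p - 1 - i))"
    unfolding Phi_def by (subst sum.atLeastAtMost_rev) simp
  also have "\<dots> = (\<Sum>i = 0..p - 1. y ^ (p - 1) * (- x / y) ^ i)"
  proof (rule sum.cong)
    fix i assume i: "i \<in> {0..p - 1}"
    have "(- 1 :: 'a) ^ (p - 1 - i) = (- 1) ^ i"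
      using i \<open>odd p\<close> odd_pos[OF \<open>odd p\<close>] by (auto simp: uminus_power_if)
    moreover have "y ^ (p - 1) = y ^ (p - 1 - i) * y ^ i"
      using i odd_pos[OF \<open>odd p\<close>] by (simp flip: power_add)
    moreover have "p - 1 - (p - 1 - i) = i"
      using i by simp
    ultimately show "(- 1) ^ (p - 1 - i) * x ^ (p - 1 - (p - 1 - i)) * y ^ (p - 1 - i)
        = y ^ (p - 1) * (- x / y) ^ i"
      using \<open>y \<noteq> 0\<close>
      by (simp del: One_nat_def diff_diff_left add: power_divide power_minus[of x] power_minus[of "x / y"])
  qed simp
  also have "{0..p - 1} = {..<p}"
    using odd_pos[OF \<open>odd p\<close>] by auto
  finally show ?thesis
    by (simp add: sum_distrib_left)
qed

section \<open>The relation\<close>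

theorem proposition3p18:
  fixes p :: nat and P :: "complex set" and \<omega> \<chi> \<chi>' :: "int \<Rightarrow> complex"
  assumes "prime p" and "p > 2"
    and "prime_ideal_above p (cyclotomic_field (p - 1)) P"
    and "teichmuller_character p P \<omega>"
    and "\<chi> \<in> characters p (cyclotomic_field (p - 1))"
    and "\<chi> \<noteq> \<omega>"
    and "\<chi>' = char_mult p \<omega> (char_inv p \<chi>)"
  shows "\<exists>\<Psi> :: bipoly.
           symmetric_form \<Psi> \<and>
           homogeneous_of_degree (p - 3) \<Psi> \<and>
           coeffs_in (maximal_real_subfield (cyclotomic_field (p - 1))) \<Psi> \<and>
           M p \<chi>' (- indet_x / indet_y) * M p (char_inv p \<chi>') (- indet_y / indet_x) =
             of_nat p + Phi p indet_x indet_y *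
               (to_fract \<Psi> / (indet_x ^ (p - 2) * indet_y ^ (p - 2)))"
proof -
  define F where "F = cyclotomic_field (p - 1)"
  have \<omega>: "\<omega> \<in> characters p F" and \<chi>: "\<chi> \<in> characters p F"
    using assms by (auto simp: teichmuller_character_def F_def)
  note units = carrier_unit_residues[OF \<open>prime p\<close>]
  have \<chi>': "\<chi>' k = \<omega> k * inverse (\<chi> k)" if "k \<in> {1..int p - 1}" for k
    using that by (simp add: assms(7) char_mult_def char_inv_def units)
  have \<chi>'_F: "\<chi>' k \<in> F" and \<chi>'_nonzero: "\<chi>' k \<noteq> 0" if k: "k \<in> {1..int p - 1}" for k
    using k character_in_field[OF \<open>prime p\<close> \<omega> k] character_in_field[OF \<open>prime p\<close> \<chi> k]
      character_nonzero[OF \<open>prime p\<close> \<omega> k] character_nonzero[OF \<open>prime p\<close> \<chi> k]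
    by (auto simp: \<chi>' F_def intro!: cyclotomic_field_mult cyclotomic_field_inverse)
  define f where "f n = (if int p dvd n then 0 else \<chi>' (n mod int p))" for n
  have f: "nontrivial_residue_character p f"
    unfolding f_def
  proof (rule zero_extension_character)
    fix k l assume kl: "k \<in> {1..int p - 1}" "l \<in> {1..int p - 1}"
    have "\<not> int p dvd k * l"
      using kl \<open>prime p\<close> by (auto simp: prime_dvd_mult_iff dest: zdvd_imp_le)
    then have "k * l mod int p \<in> {1..int p - 1}"
      using \<open>p > 2\<close> by (intro mod_in_units) auto
    then show "\<chi>' (k * l mod int p) = \<chi>' k * \<chi>' l"
      using kl by (simp add: \<chi>' character_mult[OF \<open>prime p\<close> \<omega>] character_mult[OF \<open>prime p\<close> \<chi>])
  next
    have "\<exists>k\<in>{1..int p - 1}. \<omega> k \<noteq> \<chi> k"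
      using \<omega> \<chi> \<open>\<chi> \<noteq> \<omega>\<close> extensionalityI[of \<chi> "{1..int p - 1}" \<omega>]
      by (auto simp: characters_def units)
    then show "\<exists>k\<in>{1..int p - 1}. \<chi>' k \<noteq> 1"
      using character_nonzero[OF \<open>prime p\<close> \<chi>] by (fastforce simp: \<chi>' field_simps)
  qed (use \<open>prime p\<close> \<chi>'_nonzero in auto)
  interpret nontrivial_residue_character p f by fact

  define c where "c = correlation"
  have f_F: "f n \<in> F" "inverse (f n) \<in> F" for n
  proof -
    have "n mod int p \<in> {1..int p - 1}" if "\<not> int p dvd n"
      using that \<open>p > 2\<close> by (intro mod_in_units) auto
    then show "f n \<in> F" "inverse (f n) \<in> F"
      using \<chi>'_F \<chi>'_nonzero by (auto simp: f_def F_def cyclotomic_field_0 intro!: cyclotomic_field_inverse)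
  qed
  have c_F: "c d \<in> F \<inter> \<real>" for d
    using f_F correlation_real[OF f]
    by (auto simp: c_def correlation_def F_def intro!: cyclotomic_field_sum cyclotomic_field_mult)
  have c_compl: "c d + c (p - d) = -1" if "0 < d" "d < p" for d
    using that unfolding c_def by (rule correlation_complement)

  obtain m where p: "p = m + 3"
    using \<open>p > 2\<close> by (metis add.commute less_iff_Suc_add add_Suc_right numeral_2_eq_2 numeral_3_eq_3 add_2_eq_Suc)
  have "odd p"
    using assms(1,2) prime_odd_nat by auto
  then have "even m"
    by (simp add: p)
  \<comment> \<open>The powers of \<open>-1\<close> come from homogenising a polynomial in \<open>- x / y\<close>; the leading sign comes from
    \<open>W ^ (p - 2)\<close>, whose exponent is odd.\<close>
  define q where "q i = - ((- 1) ^ i * (c (i + 1) - c (i + 2)))" for i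
  define \<Psi> where "\<Psi> = binary_form m q"

  have "symmetric_form \<Psi>"
  proof -
    have "q i = q j" if ij: "i + j = m" for i j
    proof -
      have e: "p - (i + 1) = j + 2" "p - (i + 2) = j + 1"
        using ij p by auto
      have "c (i + 1) + c (j + 2) = c (i + 2) + c (j + 1)"
        using c_compl[of "i + 1"] c_compl[of "i + 2"] ij p unfolding e by simp
      then have "c (i + 1) = c (i + 2) + c (j + 1) - c (j + 2)"
        by (simp only: eq_diff_eq)
      then have "c (i + 1) - c (i + 2) = c (j + 1) - c (j + 2)"
        by simp
      moreover have "(- 1 :: complex) ^ i = (- 1) ^ j"
        using \<open>even m\<close> ij by (auto simp: uminus_power_if)
      ultimately show ?thesis
        unfolding q_def by simp
    qed
    then show ?thesis
      by (auto simp: symmetric_form_def \<Psi>_def coeff2_binary_form add.commute)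
  qed
  moreover have "homogeneous_of_degree (p - 3) \<Psi>"
    by (auto simp: homogeneous_of_degree_def \<Psi>_def coeff2_binary_form p)
  moreover have "coeffs_in (maximal_real_subfield (cyclotomic_field (p - 1))) \<Psi>"
  proof -
    have "(-1) ^ i \<in> F" for i
      by (auto simp: uminus_power_if F_def cyclotomic_field_1 cyclotomic_field_uminus)
    then have "q i \<in> F" for i
      using c_F unfolding q_def diff_conv_add_uminus F_def
      by (intro cyclotomic_field_uminus cyclotomic_field_mult cyclotomic_field_add) auto
    moreover have "q i \<in> \<real>" for i
      using c_F unfolding q_def by auto
    ultimately show ?thesis
      by (simp add: coeffs_in_def maximal_real_subfield_def \<Psi>_def coeff2_binary_form
          F_def cyclotomic_field_0)
  qed
  moreover have "M p \<chi>' (- indet_x / indet_y) * M p (char_inv p \<chi>') (- indet_y / indet_x) =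
      of_nat p + Phi p indet_x indet_y *
        (to_fract \<Psi> / (indet_x ^ (p - 2) * indet_y ^ (p - 2)))"
  proof -
    define Z where "Z = - indet_x / indet_y"
    define W where "W = - indet_y / indet_x"
    have x0: "indet_x \<noteq> 0" and y0: "indet_y \<noteq> 0"
      by (simp_all add: indet_x_def indet_y_def)
    then have ZW: "Z * W = 1"
      by (simp add: Z_def W_def)
    define S where "S = (\<Sum>j<p. Z ^ j)"
    define Q where "Q = (\<Sum>j<p - 2. (const2 (c (j + 1)) - const2 (c (j + 2))) * Z ^ j)"
    have M_eq: "M p \<phi> T = (\<Sum>k<p. const2 (g (int k)) * T ^ k)"
      if g: "\<And>k. k \<in> {1..int p - 1} \<Longrightarrow> inverse (\<phi> k) = g k" and "g 0 = 0" for \<phi> g T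
    proof -
      have "M p \<phi> T = (\<Sum>k = 1..p - 1. const2 (g (int k)) * T ^ k)"
        unfolding M_def by (intro sum.cong) (auto simp: char_inv_def units g)
      also have "\<dots> = (\<Sum>k<p. const2 (g (int k)) * T ^ k)"
        using \<open>g 0 = 0\<close>
        by (intro sum.mono_neutral_left) (auto simp: const2_0 Suc_le_eq p)
      finally show ?thesis .
    qed
    have f_unit: "f k = \<chi>' k" if "k \<in> {1..int p - 1}" for k
      using that by (auto simp: f_def dest: zdvd_imp_le)
    have M1: "M p \<chi>' Z = (\<Sum>k<p. const2 (inverse (f (int k))) * Z ^ k)"
      by (rule M_eq[where g = "\<lambda>k. inverse (f k)"]) (simp_all add: f_unit)
    have M2: "M p (char_inv p \<chi>') W = (\<Sum>k<p. const2 (f (int k)) * W ^ k)"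
      by (rule M_eq) (simp_all add: f_unit char_inv_def units)
    have "M p \<chi>' Z * M p (char_inv p \<chi>') W
        = (\<Sum>k<p. const2 (inverse (f (int k))) * const2 (f (int k))) +
          (\<Sum>d=1..<p. const2 (c d) * Z ^ d + const2 (c d) * W ^ d)"
    proof -
      have "(\<Sum>l<p - d. const2 (inverse (f (int (l + d)))) * const2 (f (int l))) = const2 (c d)"
        "(\<Sum>l<p - d. const2 (inverse (f (int l))) * const2 (f (int (l + d)))) = const2 (c d)" for d
        unfolding const2_mult[symmetric] const2_sum[symmetric] c_def
        by (simp_all only: mult.commute[of "inverse _"] correlation_swap[symmetric] correlation_def[symmetric])
      then show ?thesis
        unfolding M1 M2 product_eq_correlation_sum[OF ZW] by simp
    qed
    also have "(\<Sum>k<p. const2 (inverse (f (int k))) * const2 (f (int k))) = of_nat p - 1"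
      unfolding const2_mult[symmetric] const2_sum[symmetric] mult.commute[of "inverse _"] sum_mult_inverse
      by (simp add: const2_diff const2_of_nat const2_1)
    also have "of_nat p - 1 + (\<Sum>d=1..<p. const2 (c d) * Z ^ d + const2 (c d) * W ^ d)
        = of_nat p + ((\<Sum>d=1..<p. const2 (c d) * (Z ^ d + W ^ d)) - 1)"
      by (simp add: distrib_left)
    also have "(\<Sum>d=1..<p. const2 (c d) * (Z ^ d + W ^ d)) - 1 = S * W ^ (p - 2) * Q"
      unfolding S_def Q_def
    proof (rule reciprocal_sum_factorization[OF _ ZW])
      show "const2 (c d) + const2 (c (p - d)) = - 1" if "0 < d" "d < p" for d
        using c_compl[OF that] by (metis const2_add const2_minus const2_1)
    qed (use \<open>p > 2\<close> correlation_last in \<open>auto simp: c_def const2_0\<close>)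
    also have "S * W ^ (p - 2) * Q = Phi p indet_x indet_y *
        (to_fract \<Psi> / (indet_x ^ (p - 2) * indet_y ^ (p - 2)))"
    proof -
      have Phi: "Phi p indet_x indet_y = indet_y ^ (p - 1) * S"
        unfolding S_def Z_def by (rule Phi_eq_geometric_sum) (use \<open>odd p\<close> y0 in auto)
      have "to_fract \<Psi> = (\<Sum>i\<le>m. - (indet_y ^ m * ((const2 (c (i + 1)) - const2 (c (i + 2))) * Z ^ i)))"
        unfolding \<Psi>_def to_fract_binary_form
      proof (rule sum.cong)
        fix i assume "i \<in> {..m}"
        then have ym: "indet_y ^ m = indet_y ^ (m - i) * indet_y ^ i"
          by (simp flip: power_add)
        have "Z * indet_y = - indet_x"
          using y0 by (simp add: Z_def)
        then have Zy: "Z ^ i * indet_y ^ i = (- 1) ^ i * indet_x ^ i"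
          by (metis power_minus power_mult_distrib)
        have "indet_y ^ m * Z ^ i = indet_y ^ (m - i) * (Z ^ i * indet_y ^ i)"
          unfolding ym by (simp only: ac_simps)
        then have "indet_y ^ m * Z ^ i = (- 1) ^ i * indet_x ^ i * indet_y ^ (m - i)"
          unfolding Zy by (simp only: ac_simps)
        moreover have "const2 (q i) = - ((- 1) ^ i * (const2 (c (i + 1)) - const2 (c (i + 2))))"
          by (simp add: q_def const2_minus const2_mult const2_diff const2_power const2_1)
        ultimately show "const2 (q i) * indet_x ^ i * indet_y ^ (m - i)
            = - (indet_y ^ m * ((const2 (c (i + 1)) - const2 (c (i + 2))) * Z ^ i))"
          by (simp add: ac_simps)
      qed simp
      also have "\<dots> = - (indet_y ^ m * Q)"
        by (simp add: Q_def p sum_negf lessThan_Suc_atMost flip: sum_distrib_left)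
      finally have \<Psi>: "to_fract \<Psi> = - (indet_y ^ m * Q)" .
      have W: "W ^ (p - 2) = - (indet_y ^ (m + 1) / indet_x ^ (m + 1))"
        using \<open>even m\<close> by (simp add: W_def p power_divide)
      show ?thesis
        unfolding Phi \<Psi> W using x0 y0 by (simp add: p field_simps)
    qed
    finally show ?thesis
      unfolding Z_def W_def .
  qed
  ultimately show ?thesis
    by blast
qed

end
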